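(* Let $\mathcal S$ be the state space of the space $O$ of self-adjoint $3\times 3$ Toeplitz matrices, let $E$ be the set of extreme points of $\mathcal S$, let $\mathbb T=\mathbb R/2\pi\mathbb Z$, and let $\Delta\subset\mathbb T^2$ be the diagonal. Define $\epsilon:\mathbb T^2\to O^*$ by $$\epsilon(x,y)=\frac{1}{\cos(x-y)+2}\bigl(2(\cos x+\cos y),\,2(\sin x+\sin y),\,\cos(x+y),\,\sin(x+y)\bigr)$$ in the coordinates $(W,X,Y,Z)$ of linear forms normalized to take the value $1$ on the identity matrix. Then: 1. $\epsilon$ takes values in $\mathcal S$ and defines a surjective double cover of $E$ (folded along the diagonal, i.e. $\epsilon$ maps onto $E$ and $\epsilon(x,y)=\epsilon(x',y')$ if and only if $(x',y')\in\{(x,y),(y,x)\}$), and $E$ is a Möbius strip with boundary $\epsilon(\Delta)$. 2. The Möbius strip $E$ lies in the singular set of the hypersurface $d(W,X,Y,Z)=0$ (i.e. $d$ and its gradient vanish on $E$), where $d$ is the polynomial given in the context. 3. The map $\beta:\mathbb T^2\times[0,1]\to O^*$, $$\beta(x,y,s):=s\,\epsilon(x,y)+(1-s)\,\epsilon(x,y+\pi),$$ is a surjection onto the boundary $\partial\mathcal S$ of $\mathcal S$.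
   Context: $O$ is the $5$-dimensional real vector space of matrices $$\begin{pmatrix} u & a-ib & c-id \\ a+ib & u & a-ib \\ c+id & a+ib & u\end{pmatrix},\qquad(a,b,c,d,u)\in\mathbb R^5.$$ $O_+\subset O$ is the cone of positive semidefinite matrices. $\mathcal S\subset O^*$ is the set of real linear forms on $O$ which are nonnegative on $O_+$ and equal to $1$ on the identity matrix. Linear forms with value $1$ on the identity are written $L(a,b,c,d,u)=aW+bX+cY+dZ+u$, and identified with $(W,X,Y,Z)\in\mathbb R^4$; the boundary $\partial\mathcal S$ is taken in this $\mathbb R^4$. The polynomial $d$ is $$\begin{aligned} d(W,X,Y,Z)={}&W^6+3W^4X^2+15W^4Y^2-18W^4Y-12W^4Z^2-W^4+108W^3XYZ\\ &-36W^3XZ+3W^2X^4-78W^2X^2Y^2+84W^2X^2Z^2-2W^2X^2+48W^2Y^4-144W^2Y^3\\ &+96W^2Y^2Z^2+80W^2Y^2-144W^2YZ^2+16W^2Y+48W^2Z^4+80W^2Z^2-108WX^3YZ\\ &-36WX^3Z-288WXY^2Z-288WXZ^3+32WXZ+X^6+15X^4Y^2+18X^4Y-12X^4Z^2\\ &-X^4+48X^2Y^4+144X^2Y^3+96X^2Y^2Z^2+80X^2Y^2+144X^2YZ^2-16X^2Y+48X^2Z^4\\ &+80X^2Z^2-64Y^6-192Y^4Z^2+128Y^4-192Y^2Z^4+256Y^2Z^2-64Y^2-64Z^6+128Z^4-64Z^2. \end{aligned}$$ (Up to a factor it is the discriminant in $t$ of the quartic $-t^4X-t^4Y+t^4+2t^3W-4t^3Z+6t^2Y+2t^2+2tW+4tZ+X-Y+1$.)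 *)

theory Defs
  imports "HOL-Analysis.Analysis" "HOL-Library.Real_Mod"
begin

section \<open>The space of self-adjoint Toeplitz matrices and its state space\<close>

definition toeplitz :: "real \<Rightarrow> real \<Rightarrow> real \<Rightarrow> real \<Rightarrow> real \<Rightarrow> complex^3^3" where
  "toeplitz a b c d u = vector [
     vector [complex_of_real u, Complex a (- b),     Complex c (- d)],
     vector [Complex a b,       complex_of_real u,   Complex a (- b)],
     vector [Complex c d,       Complex a b,         complex_of_real u]]"

definition toep_space :: "(complex^3^3) set" where
  "toep_space = {toeplitz a b c d u | a b c d u. True}"

text \<open>Membership in \<open>\<real>\<^sub>\<ge>\<^sub>0\<close> says that the sesquilinear form takes real values \<open>\<ge> 0\<close>.\<close>

definition pos_semidef :: "complex^'n^'n \<Rightarrow> bool" where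
  "pos_semidef M \<longleftrightarrow>
     (\<forall>v. (\<Sum>i\<in>UNIV. \<Sum>j\<in>UNIV. cnj (v $ i) * M $ i $ j * v $ j) \<in> \<real>\<^sub>\<ge>\<^sub>0)"

definition toep_cone :: "(complex^3^3) set" where
  "toep_cone = {M \<in> toep_space. pos_semidef M}"

text \<open>
  A linear form on \<open>toep_space\<close> is a function on the ambient matrix space that is linear on
  \<open>toep_space\<close> and takes the default value \<open>undefined\<close> outside it, so that two forms are
  equal as soon as they agree on \<open>toep_space\<close>.
\<close>

definition toep_dual :: "(complex^3^3 \<Rightarrow> real) set" where
  "toep_dual = {L \<in> extensional toep_space.
     (\<forall>M\<in>toep_space. \<forall>N\<in>toep_space. L (M + N) = L M + L N) \<and>
     (\<forall>r. \<forall>M\<in>toep_space. L (r *\<^sub>R M) = r * L M)}"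

definition states :: "(complex^3^3 \<Rightarrow> real) set" where
  "states = {L \<in> toep_dual. (\<forall>M\<in>toep_cone. 0 \<le> L M) \<and> L (mat 1) = 1}"

text \<open>
  The coordinates \<open>(W, X, Y, Z)\<close> of the forms with value \<open>1\<close> on the identity; the entries
  of \<open>toeplitz a b c d u\<close> below are \<open>a\<close>, \<open>b\<close>, \<open>c\<close>, \<open>d\<close> and \<open>u\<close>.
\<close>

definition form :: "real^4 \<Rightarrow> complex^3^3 \<Rightarrow> real" where
  "form w = (\<lambda>M\<in>toep_space. Re (M $ 2 $ 1) * w $ 1 + Im (M $ 2 $ 1) * w $ 2
     + Re (M $ 3 $ 1) * w $ 3 + Im (M $ 3 $ 1) * w $ 4 + Re (M $ 1 $ 1))"

lemma toeplitz_in_toep_space: "toeplitz a b c d u \<in> toep_space"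
  unfolding toep_space_def by blast

lemma form_toeplitz:
  "form w (toeplitz a b c d u) = a * w $ 1 + b * w $ 2 + c * w $ 3 + d * w $ 4 + u"
  by (simp add: form_def toeplitz_in_toep_space) (simp add: toeplitz_def)

lemma mat_1_eq_toeplitz: "mat 1 = toeplitz 0 0 0 0 1"
  by (simp add: toeplitz_def vec_eq_iff forall_3 mat_def complex_eq_iff)

lemma toeplitz_add:
  "toeplitz a b c d u + toeplitz a' b' c' d' u' = toeplitz (a + a') (b + b') (c + c') (d + d') (u + u')"
  by (simp add: toeplitz_def vec_eq_iff forall_3 complex_eq_iff)

lemma toeplitz_scaleR:
  "r *\<^sub>R toeplitz a b c d u = toeplitz (r * a) (r * b) (r * c) (r * d) (r * u)"
  by (simp add: toeplitz_def vec_eq_iff forall_3 complex_eq_iff)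

text \<open>This identifies \<open>real^4\<close> with the affine hyperplane of normalized forms.\<close>

lemma bij_betw_form: "bij_betw form UNIV {L \<in> toep_dual. L (mat 1) = 1}"
proof (rule bij_betw_imageI)
  show "inj form"
  proof (rule injI)
    fix v w assume "form v = form w"
    then have "form v (toeplitz a b c d u) = form w (toeplitz a b c d u)" for a b c d u
      by simp
    from this[of 1 0 0 0 0] this[of 0 1 0 0 0] this[of 0 0 1 0 0] this[of 0 0 0 1 0]
    show "v = w"
      by (simp add: form_toeplitz vec_eq_iff forall_4)
  qed
  show "range form = {L \<in> toep_dual. L (mat 1) = 1}"
  proof (intro equalityI subsetI)
    fix L assume "L \<in> range form"
    then obtain w where L: "L = form w" by blast
    have "form w \<in> extensional toep_space"
      by (simp add: form_def)
    moreover have "form w (M + N) = form w M + form w N"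
      if "M \<in> toep_space" "N \<in> toep_space" for M N
      using that by (auto simp: toep_space_def toeplitz_add form_toeplitz algebra_simps)
    moreover have "form w (r *\<^sub>R M) = r * form w M" if "M \<in> toep_space" for r M
      using that by (auto simp: toep_space_def toeplitz_scaleR form_toeplitz algebra_simps)
    ultimately show "L \<in> {L \<in> toep_dual. L (mat 1) = 1}"
      by (auto simp: L toep_dual_def mat_1_eq_toeplitz form_toeplitz)
  next
    fix L assume "L \<in> {L \<in> toep_dual. L (mat 1) = 1}"
    then have ext: "L \<in> extensional toep_space"
      and add: "\<And>M N. M \<in> toep_space \<Longrightarrow> N \<in> toep_space \<Longrightarrow> L (M + N) = L M + L N"
      and scale: "\<And>r M. M \<in> toep_space \<Longrightarrow> L (r *\<^sub>R M) = r * L M"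
      and one: "L (toeplitz 0 0 0 0 1) = 1"
      by (auto simp: toep_dual_def mat_1_eq_toeplitz)
    define w :: "real^4" where "w = vector [L (toeplitz 1 0 0 0 0), L (toeplitz 0 1 0 0 0),
      L (toeplitz 0 0 1 0 0), L (toeplitz 0 0 0 1 0)]"
    have w_nth: "w $ 1 = L (toeplitz 1 0 0 0 0)" "w $ 2 = L (toeplitz 0 1 0 0 0)"
      "w $ 3 = L (toeplitz 0 0 1 0 0)" "w $ 4 = L (toeplitz 0 0 0 1 0)"
      by (simp_all add: w_def vector_def)
    have space: "M + N \<in> toep_space" if "M \<in> toep_space" "N \<in> toep_space" for M N
      using that unfolding toep_space_def by (auto simp: toeplitz_add) blast
    have space': "r *\<^sub>R M \<in> toep_space" if "M \<in> toep_space" for r M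
      using that unfolding toep_space_def by (auto simp: toeplitz_scaleR) blast
    have "L = form w"
    proof (rule extensionalityI[OF ext])
      show "form w \<in> extensional toep_space" by (simp add: form_def)
      fix M assume "M \<in> toep_space"
      then obtain a b c d u where M: "M = toeplitz a b c d u"
        by (auto simp: toep_space_def)
      have "M = a *\<^sub>R toeplitz 1 0 0 0 0 + (b *\<^sub>R toeplitz 0 1 0 0 0
          + (c *\<^sub>R toeplitz 0 0 1 0 0 + (d *\<^sub>R toeplitz 0 0 0 1 0 + u *\<^sub>R toeplitz 0 0 0 0 1)))"
        by (simp add: M toeplitz_add toeplitz_scaleR)
      also have "L \<dots> = a * w $ 1 + (b * w $ 2 + (c * w $ 3 + (d * w $ 4 + u)))"
        using one by (simp add: add scale space space' toeplitz_in_toep_space w_nth)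
      finally show "L M = form w M"
        by (simp add: M form_toeplitz)
    qed
    then show "L \<in> range form" by blast
  qed
qed

definition state_space :: "(real^4) set" where
  "state_space = {w. form w \<in> states}"

definition extreme_states :: "(real^4) set" where
  "extreme_states = {w. w extreme_point_of state_space}"

section \<open>The circle of real numbers modulo \<open>2\<pi>\<close>\<close>

quotient_type circle = real / "\<lambda>x y. [x = y] (rmod (2 * pi))"
  by (auto intro!: equivpI reflpI sympI transpI intro: rcong_sym rcong_trans)

instantiation circle :: ab_group_add
begin

lift_definition zero_circle :: circle is 0 .
lift_definition plus_circle :: "circle \<Rightarrow> circle \<Rightarrow> circle" is "(+)"
  by (rule rcong_add)
lift_definition minus_circle :: "circle \<Rightarrow> circle \<Rightarrow> circle" is "(-)"
  by (rule rcong_diff)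
lift_definition uminus_circle :: "circle \<Rightarrow> circle" is uminus
  by (rule rcong_uminus)

instance
  by standard (transfer; simp add: algebra_simps)+

end

text \<open>The quotient topology of the usual topology on the reals.\<close>

instantiation circle :: topological_space
begin

definition open_circle :: "circle set \<Rightarrow> bool" where
  "open_circle U \<longleftrightarrow> open (abs_circle -` U)"

instance
  by standard (auto simp: open_circle_def vimage_Union)

end

lift_definition circle_cos :: "circle \<Rightarrow> real" is cos
  by (metis cos_rmod rcong_def)
lift_definition circle_sin :: "circle \<Rightarrow> real" is sin
  by (metis sin_rmod rcong_def)

section \<open>The Moebius strip\<close>

definition quotient_topology :: "'a topology \<Rightarrow> ('a \<times> 'a) set \<Rightarrow> 'a set topology" where
  "quotient_topology X R = topology (\<lambda>U. U \<subseteq> topspace X // R \<and> openin X (\<Union>U))"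

lemma openin_quotient_topology:
  assumes "equiv (topspace X) R"
  shows "openin (quotient_topology X R) U \<longleftrightarrow> U \<subseteq> topspace X // R \<and> openin X (\<Union>U)"
proof -
  have "istopology (\<lambda>U. U \<subseteq> topspace X // R \<and> openin X (\<Union>U))"
    unfolding istopology_def
  proof (intro conjI allI impI; (elim conjE)?)
    fix S T assume ST: "S \<subseteq> topspace X // R" "T \<subseteq> topspace X // R"
      and op: "openin X (\<Union>S)" "openin X (\<Union>T)"
    show "S \<inter> T \<subseteq> topspace X // R" using ST by blast
    have "\<Union>(S \<inter> T) = \<Union>S \<inter> \<Union>T"
      using ST quotient_disj[OF assms] by blast
    then show "openin X (\<Union>(S \<inter> T))" using op by auto
  next
    fix K assume K: "\<forall>S\<in>K. S \<subseteq> topspace X // R \<and> openin X (\<Union>S)"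
    show "\<Union>K \<subseteq> topspace X // R" using K by blast
    have "\<Union>(\<Union>K) = (\<Union>S\<in>K. \<Union>S)" by blast
    then show "openin X (\<Union>(\<Union>K))" using K by (auto intro: openin_Union)
  qed
  then show ?thesis
    by (simp add: quotient_topology_def)
qed

text \<open>The unit square with \<open>(0, t)\<close> glued to \<open>(1, 1 - t)\<close>.\<close>

definition moebius_rel :: "((real \<times> real) \<times> (real \<times> real)) set" where
  "moebius_rel = {(p, q). p \<in> {0..1} \<times> {0..1} \<and> q \<in> {0..1} \<times> {0..1} \<and>
     (p = q \<or> (\<exists>t. {p, q} = {(0, t), (1, 1 - t)}))}"

lemma equiv_moebius_rel: "equiv ({0..1} \<times> {0..1}) moebius_rel"
  by (rule equivI)
     (auto simp: moebius_rel_def refl_on_def sym_def trans_def doubleton_eq_iff)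

definition moebius_strip :: "(real \<times> real) set topology" where
  "moebius_strip = quotient_topology (top_of_set ({0..1} \<times> {0..1})) moebius_rel"

definition moebius_boundary :: "(real \<times> real) set set" where
  "moebius_boundary = (\<lambda>p. moebius_rel `` {p}) ` ({0..1} \<times> {0, 1})"

definition is_moebius_strip :: "'a::topological_space set \<Rightarrow> 'a set \<Rightarrow> bool" where
  "is_moebius_strip A B \<longleftrightarrow>
     (\<exists>h. homeomorphic_map moebius_strip (top_of_set A) h \<and> h ` moebius_boundary = B)"

section \<open>The parametrizations and the discriminant hypersurface\<close>

text \<open>
  The trigonometric polynomial \<open>W * cos \<theta> + X * sin \<theta> + Y * cos (2 * \<theta>) + Z * sin (2 * \<theta>) + 1\<close>
  of \<open>eps (x, y)\<close> is the multiple of \<open>(1 + cos (\<theta> - x)) * (1 + cos (\<theta> - y))\<close> with constant term \<open>1\<close>.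
\<close>

definition eps :: "circle \<times> circle \<Rightarrow> real^4" where
  "eps = (\<lambda>(x, y). (1 / (circle_cos (x - y) + 2)) *\<^sub>R
     vector [2 * (circle_cos x + circle_cos y), 2 * (circle_sin x + circle_sin y),
             circle_cos (x + y), circle_sin (x + y)])"

definition diagonal :: "(circle \<times> circle) set" where
  "diagonal = {(x, x) | x. True}"

definition beta :: "circle \<times> circle \<times> real \<Rightarrow> real^4" where
  "beta = (\<lambda>(x, y, s). s *\<^sub>R eps (x, y) + (1 - s) *\<^sub>R eps (x, y + abs_circle pi))"

text \<open>
  Up to a factor, the discriminant in \<open>t\<close> of the quartic
  \<open>(1 + t\<^sup>2)\<^sup>2 * (W * cos \<theta> + X * sin \<theta> + Y * cos (2 * \<theta>) + Z * sin (2 * \<theta>) + 1)\<close>,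
  where \<open>cos \<theta> = 2 * t / (1 + t\<^sup>2)\<close> and \<open>sin \<theta> = (1 - t\<^sup>2) / (1 + t\<^sup>2)\<close>.
\<close>

definition disc_poly :: "real^4 \<Rightarrow> real" where
  "disc_poly w = (let W = w $ 1; X = w $ 2; Y = w $ 3; Z = w $ 4 in
      W^6 + 3 * W^4 * X^2 + 15 * W^4 * Y^2 - 18 * W^4 * Y - 12 * W^4 * Z^2 - W^4
      + 108 * W^3 * X * Y * Z - 36 * W^3 * X * Z + 3 * W^2 * X^4 - 78 * W^2 * X^2 * Y^2
      + 84 * W^2 * X^2 * Z^2 - 2 * W^2 * X^2 + 48 * W^2 * Y^4 - 144 * W^2 * Y^3
      + 96 * W^2 * Y^2 * Z^2 + 80 * W^2 * Y^2 - 144 * W^2 * Y * Z^2 + 16 * W^2 * Y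
      + 48 * W^2 * Z^4 + 80 * W^2 * Z^2 - 108 * W * X^3 * Y * Z - 36 * W * X^3 * Z
      - 288 * W * X * Y^2 * Z - 288 * W * X * Z^3 + 32 * W * X * Z + X^6 + 15 * X^4 * Y^2
      + 18 * X^4 * Y - 12 * X^4 * Z^2 - X^4 + 48 * X^2 * Y^4 + 144 * X^2 * Y^3
      + 96 * X^2 * Y^2 * Z^2 + 80 * X^2 * Y^2 + 144 * X^2 * Y * Z^2 - 16 * X^2 * Y
      + 48 * X^2 * Z^4 + 80 * X^2 * Z^2 - 64 * Y^6 - 192 * Y^4 * Z^2 + 128 * Y^4
      - 192 * Y^2 * Z^4 + 256 * Y^2 * Z^2 - 64 * Y^2 - 64 * Z^6 + 128 * Z^4 - 64 * Z^2)"

definition disc_singular_set :: "(real^4) set" where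
  "disc_singular_set = {w. disc_poly w = 0 \<and> GDERIV disc_poly w :> 0}"

end

theory Submission
  imports Defs
begin

text \<open>
  The moment matrices of the points of the circle are positive semidefinite Toeplitz matrices, so
  a state gives a nonnegative trigonometric polynomial of degree two with constant term \<open>1\<close>.
  Such a polynomial with a zero at \<open>x + pi\<close> has the form
  \<open>(1 + cos (\<theta> - x)) * (A + R * cos (\<theta> - y))\<close> with \<open>0 \<le> R \<le> A\<close>, which is a
  convex combination of the polynomials of \<open>eps (x, y)\<close> and \<open>eps (x, y + pi)\<close>. A nonnegative
  polynomial without zeros becomes one with a zero on subtracting its minimum, so the states are
  exactly the nonnegative polynomials and the boundary consists of those having a zero.
  A nonnegative polynomial dominated by a multiple of that of \<open>eps (x, y)\<close> is proportional to
  it, which gives extremality.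
\<close>

section \<open>Trigonometric polynomials of linear forms\<close>

text \<open>The value of the form on the rank-one Toeplitz matrix \<open>v v*\<close> with
  \<open>v = (1, e^(i theta), e^(2 i theta))\<close>.\<close>

definition trig_poly :: "real^4 \<Rightarrow> real \<Rightarrow> real" where
  "trig_poly w \<theta> = w $ 1 * cos \<theta> + w $ 2 * sin \<theta> + w $ 3 * cos (2 * \<theta>) + w $ 4 * sin (2 * \<theta>) + 1"

lemma vector_nth_4:
  "(vector [a, b, c, d] :: real^4) $ 1 = a" "(vector [a, b, c, d] :: real^4) $ 2 = b"
  "(vector [a, b, c, d] :: real^4) $ 3 = c" "(vector [a, b, c, d] :: real^4) $ 4 = d"
  by (simp_all add: vector_def)

lemma trig_poly_eq_form:
  "trig_poly w \<theta> = form w (toeplitz (cos \<theta>) (sin \<theta>) (cos (2 * \<theta>)) (sin (2 * \<theta>)) 1)"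
  by (simp add: trig_poly_def form_toeplitz mult.commute)

lemma trig_poly_eq_inner:
  "trig_poly w \<theta> = w \<bullet> vector [cos \<theta>, sin \<theta>, cos (2 * \<theta>), sin (2 * \<theta>)] + 1"
  by (simp add: trig_poly_def inner_vec_def sum_4 vector_nth_4)

lemma trig_poly_affine:
  "trig_poly (s *\<^sub>R v + (1 - s) *\<^sub>R w) \<theta> = s * trig_poly v \<theta> + (1 - s) * trig_poly w \<theta>"
  by (simp add: trig_poly_def algebra_simps)

text \<open>Four angles suffice: 0 and \<open>pi\<close> determine the first and third coordinates,
  \<open>pi / 2\<close> then the second, and \<open>pi / 4\<close> the fourth.\<close>

lemma trig_poly_inject:
  assumes "\<And>\<theta>. trig_poly v \<theta> = trig_poly w \<theta>"
  shows "v = w"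
proof -
  have *: "cos (2 * (pi / 4)) = 0" "sin (2 * (pi / 4)) = 1"
    by simp_all
  have "cos (2 * (pi / 2)) = -1" "sin (2 * (pi / 2)) = 0"
    by simp_all
  with assms[of 0] assms[of pi] assms[of "pi / 2"]
  have "v $ 1 = w $ 1" "v $ 2 = w $ 2" "v $ 3 = w $ 3"
    by (simp_all add: trig_poly_def)
  with assms[of "pi / 4"] * show ?thesis
    by (simp add: trig_poly_def vec_eq_iff forall_4)
qed

lemma continuous_trig_poly: "continuous_on S (trig_poly w)"
  unfolding trig_poly_def by (intro continuous_intros)

lemma trig_poly_periodic: "trig_poly w (\<theta> + of_int n * (2 * pi)) = trig_poly w \<theta>"
proof -
  have "[\<theta> = \<theta> + of_int n * (2 * pi)] (rmod (2 * pi))"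
    "[2 * \<theta> = 2 * (\<theta> + of_int n * (2 * pi))] (rmod (2 * pi))"
    unfolding rcong_altdef by (rule exI[of _ n], simp, rule exI[of _ "2 * n"], simp)
  then show ?thesis
    unfolding trig_poly_def using sin_rcong cos_rcong by metis
qed

section \<open>The parametrization\<close>

lemma circle_cos_abs [simp]: "circle_cos (abs_circle x) = cos x"
  by (rule circle_cos.abs_eq)

lemma circle_sin_abs [simp]: "circle_sin (abs_circle x) = sin x"
  by (rule circle_sin.abs_eq)

lemma abs_circle_eq_iff: "abs_circle x = abs_circle y \<longleftrightarrow> cos x = cos y \<and> sin x = sin y"
  unfolding circle.abs_eq_iff cis_eq_iff[symmetric] by (simp add: complex_eq_iff)

text \<open>The chord between the two points of the unit circle has squared length
  \<open>2 - 2 * cos (x - y)\<close>.\<close>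

lemma abs_circle_eq_iff_cos_diff: "abs_circle x = abs_circle y \<longleftrightarrow> cos (x - y) = 1"
proof -
  have "(cos x - cos y)\<^sup>2 + (sin x - sin y)\<^sup>2 = 2 - 2 * cos (x - y)"
    using sin_cos_squared_add[of x] sin_cos_squared_add[of y]
    by (simp add: cos_diff power2_eq_square algebra_simps)
  then show ?thesis
    unfolding abs_circle_eq_iff using sum_power2_eq_zero_iff[of "cos x - cos y" "sin x - sin y"]
    by auto
qed

lemma circle_surj: obtains \<theta> where "x = abs_circle \<theta>"
  by (metis Quotient3_abs_rep Quotient3_circle)

lemma eps_abs:
  "eps (abs_circle x, abs_circle y) = (1 / (cos (x - y) + 2)) *\<^sub>R
     vector [2 * (cos x + cos y), 2 * (sin x + sin y), cos (x + y), sin (x + y)]"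
  by (simp add: eps_def minus_circle.abs_eq plus_circle.abs_eq)

lemma cos_add_2_pos: "cos x + 2 > (0::real)"
  using cos_ge_minus_one[of x] by linarith

text \<open>The product-to-sum formula turns the product into a trigonometric polynomial with
  constant term \<open>cos (x - y) + 2\<close>, which is the denominator in
  \<open>eps\<close>.\<close>

lemma trig_poly_eps:
  "trig_poly (eps (abs_circle x, abs_circle y)) \<theta> =
     2 * (1 + cos (\<theta> - x)) * (1 + cos (\<theta> - y)) / (cos (x - y) + 2)"
proof -
  have "cos (\<theta> - x) * cos (\<theta> - y) = (cos (x - y) + cos (2 * \<theta> - (x + y))) / 2"
    using cos_minus[of "x - y"] by (simp add: cos_times_cos algebra_simps)
  then have eq: "2 * (1 + cos (\<theta> - x)) * (1 + cos (\<theta> - y)) =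
      2 * (cos x + cos y) * cos \<theta> + 2 * (sin x + sin y) * sin \<theta>
      + cos (x + y) * cos (2 * \<theta>) + sin (x + y) * sin (2 * \<theta>) + (cos (x - y) + 2)"
    unfolding cos_diff[of \<theta>] cos_diff[of "2 * \<theta>"] by algebra
  show ?thesis
    unfolding eq using cos_add_2_pos[of "x - y"]
    by (simp add: eps_abs trig_poly_def vector_nth_4 add_divide_distrib distrib_right)
qed

text \<open>The factor \<open>1 + cos (\<theta> - x)\<close> vanishes at the antipode of
  \<open>x\<close>; hence the shift by \<open>pi\<close>, here and below.\<close>

lemma trig_poly_eps_eq_0_iff:
  "trig_poly (eps (abs_circle x, abs_circle y)) (\<theta> + pi) = 0 \<longleftrightarrow>
     abs_circle \<theta> = abs_circle x \<or> abs_circle \<theta> = abs_circle y"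
  using cos_add_2_pos[of "x - y"]
  by (auto simp: trig_poly_eps abs_circle_eq_iff_cos_diff cos_diff)

lemma eps_swap: "eps (x, y) = eps (y, x)"
proof -
  obtain a b where "x = abs_circle a" "y = abs_circle b"
    by (metis circle_surj)
  moreover have "cos (a - b) = cos (b - a)"
    by (simp add: cos_diff mult.commute)
  ultimately show ?thesis
    by (simp add: eps_abs add.commute)
qed

text \<open>The zero set of the trigonometric polynomial recovers the set of the two points, and
  hence the pair up to order.\<close>

lemma eps_eq_iff: "eps (x, y) = eps (x', y') \<longleftrightarrow> (x', y') \<in> {(x, y), (y, x)}"
proof
  assume eq: "eps (x, y) = eps (x', y')"
  obtain a b a' b' where abs: "x = abs_circle a" "y = abs_circle b" "x' = abs_circle a'" "y' = abs_circle b'"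
    by (metis circle_surj)
  have "abs_circle t = x \<or> abs_circle t = y \<longleftrightarrow> abs_circle t = x' \<or> abs_circle t = y'" for t
    using eq trig_poly_eps_eq_0_iff unfolding abs by metis
  then have "z = x \<or> z = y \<longleftrightarrow> z = x' \<or> z = y'" for z
    by (metis circle_surj)
  from this[of x] this[of y] this[of x'] this[of y']
  show "(x', y') \<in> {(x, y), (y, x)}" by auto
qed (use eps_swap in auto)

section \<open>Continuity of the parametrization\<close>

text \<open>The universal property of the quotient topology.\<close>

lemma continuous_on_circle_iff:
  "continuous_on UNIV (f :: circle \<Rightarrow> 'b::topological_space) \<longleftrightarrow> continuous_on UNIV (f \<circ> abs_circle)"
  by (simp add: continuous_on_open_vimage open_circle_def vimage_comp o_def)

lemma continuous_circle_cos: "continuous_on S circle_cos"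
  by (rule continuous_on_subset[of UNIV]) (auto simp: continuous_on_circle_iff o_def intro!: continuous_intros)

lemma continuous_circle_sin: "continuous_on S circle_sin"
  by (rule continuous_on_subset[of UNIV]) (auto simp: continuous_on_circle_iff o_def intro!: continuous_intros)

text \<open>With these, \<open>eps\<close> is a rational expression in the sines and cosines of its
  two arguments, so its continuity does not go through that of the group operations.\<close>

lemma circle_addition:
  "circle_cos (x - y) = circle_cos x * circle_cos y + circle_sin x * circle_sin y"
  "circle_cos (x + y) = circle_cos x * circle_cos y - circle_sin x * circle_sin y"
  "circle_sin (x + y) = circle_sin x * circle_cos y + circle_cos x * circle_sin y"
  by (transfer, simp add: cos_diff cos_add sin_add)+

lemma continuous_vector_4:
  assumes "continuous_on S a" "continuous_on S b" "continuous_on S c" "continuous_on S d"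
  shows "continuous_on S (\<lambda>x. vector [a x, b x, c x, d x] :: real^4)"
proof -
  have "(vector [a x, b x, c x, d x] :: real^4) =
    a x *\<^sub>R axis 1 1 + b x *\<^sub>R axis 2 1 + c x *\<^sub>R axis 3 1 + d x *\<^sub>R axis 4 1" for x
    by (simp add: vec_eq_iff forall_4 vector_nth_4 axis_def)
  then show ?thesis
    using assms by (auto intro!: continuous_intros)
qed

lemma continuous_eps: "continuous_on UNIV eps"
proof -
  have pos: "circle_cos (x - y) + 2 \<noteq> 0" for x y
    by transfer (use cos_add_2_pos in \<open>metis less_irrefl\<close>)
  have [continuous_intros]:
    "continuous_on UNIV (\<lambda>p :: circle \<times> circle. circle_cos (fst p))" "continuous_on UNIV (\<lambda>p :: circle \<times> circle. circle_cos (snd p))"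
    "continuous_on UNIV (\<lambda>p :: circle \<times> circle. circle_sin (fst p))" "continuous_on UNIV (\<lambda>p :: circle \<times> circle. circle_sin (snd p))"
    by (rule continuous_on_compose2[OF continuous_circle_cos[of UNIV]]
        continuous_on_compose2[OF continuous_circle_sin[of UNIV]];
        simp add: continuous_on_fst continuous_on_snd)+
  show ?thesis
    unfolding eps_def case_prod_unfold using pos unfolding circle_addition
    by (intro continuous_intros continuous_vector_4) auto
qed

section \<open>States and nonnegative trigonometric polynomials\<close>

lemma toeplitz_nth:
  "toeplitz a b c d u $ 1 $ 1 = of_real u" "toeplitz a b c d u $ 1 $ 2 = Complex a (- b)"
  "toeplitz a b c d u $ 1 $ 3 = Complex c (- d)" "toeplitz a b c d u $ 2 $ 1 = Complex a b"
  "toeplitz a b c d u $ 2 $ 2 = of_real u" "toeplitz a b c d u $ 2 $ 3 = Complex a (- b)"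
  "toeplitz a b c d u $ 3 $ 1 = Complex c d" "toeplitz a b c d u $ 3 $ 2 = Complex a b"
  "toeplitz a b c d u $ 3 $ 3 = of_real u"
  by (simp_all add: toeplitz_def)

text \<open>The matrix is \<open>e e*\<close> for the vector \<open>e\<close> below, so its
  quadratic form is a squared modulus.\<close>

lemma toeplitz_moment_pos_semidef:
  "pos_semidef (toeplitz (cos \<theta>) (sin \<theta>) (cos (2 * \<theta>)) (sin (2 * \<theta>)) 1)"
proof -
  define e :: "complex^3" where "e = vector [1, cis \<theta>, cis (2 * \<theta>)]"
  have "toeplitz (cos \<theta>) (sin \<theta>) (cos (2 * \<theta>)) (sin (2 * \<theta>)) 1 $ i $ j = e $ i * cnj (e $ j)" for i j
    using exhaust_3[of i] exhaust_3[of j]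
    by (auto simp: toeplitz_nth e_def cis_cnj cis_mult) (auto simp: complex_eq_iff)
  then have "(\<Sum>i\<in>UNIV. \<Sum>j\<in>UNIV. cnj (v $ i) *
       toeplitz (cos \<theta>) (sin \<theta>) (cos (2 * \<theta>)) (sin (2 * \<theta>)) 1 $ i $ j * v $ j)
     = (\<Sum>i\<in>UNIV. cnj (v $ i) * e $ i) * cnj (\<Sum>i\<in>UNIV. cnj (v $ i) * e $ i)" for v :: "complex^3"
    by (simp add: sum_product mult.commute mult.left_commute)
  then show ?thesis
    unfolding pos_semidef_def complex_norm_square[symmetric]
    by (simp del: cnj_sum)
qed

lemma trig_poly_nonneg_if_state:
  assumes "w \<in> state_space"
  shows "0 \<le> trig_poly w \<theta>"
  using assms toeplitz_moment_pos_semidef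
  by (auto simp: trig_poly_eq_form state_space_def states_def toep_cone_def toeplitz_in_toep_space)

lemma state_space_iff_form:
  "w \<in> state_space \<longleftrightarrow>
     (\<forall>a b c d u. pos_semidef (toeplitz a b c d u) \<longrightarrow> 0 \<le> form w (toeplitz a b c d u))"
proof -
  have "form w \<in> {L \<in> toep_dual. L (mat 1) = 1}"
    using bij_betw_form by (auto simp: bij_betw_def)
  then have "form w \<in> toep_dual" "form w (mat 1) = 1"
    by auto
  then show ?thesis
    unfolding state_space_def states_def toep_cone_def toep_space_def by blast
qed

text \<open>The origin stands for the form that reads off the diagonal entry \<open>u\<close>, that
  is, the normalized trace; the first unit vector shows that \<open>u\<close> is
  nonnegative.\<close>

lemma zero_in_state_space: "0 \<in> state_space"
  unfolding state_space_iff_form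
proof (intro allI impI)
  fix a b c d u assume "pos_semidef (toeplitz a b c d u)"
  from this[unfolded pos_semidef_def, rule_format, of "axis 1 1"]
  show "0 \<le> form 0 (toeplitz a b c d u)"
    by (simp add: sum_3 axis_def toeplitz_nth form_toeplitz)
qed

text \<open>
  The vector used is the conjugated coefficient vector of
  \<open>(1 + cis (- x) * z) * (1 + cis (- y) * z)\<close>, a Fejer--Riesz factor of the
  trigonometric polynomial of \<open>eps\<close>.
\<close>

lemma eps_in_state_space: "eps p \<in> state_space"
  unfolding state_space_iff_form
proof (intro allI impI)
  fix a b c d u assume psd: "pos_semidef (toeplitz a b c d u)"
  obtain x y where p: "p = (abs_circle x, abs_circle y)"
    by (metis circle_surj surj_pair)
  define S where "S = (\<Sum>i\<in>UNIV. \<Sum>j\<in>UNIV. cnj (vector [1, cis x + cis y, cis (x + y)] $ i) *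
     toeplitz a b c d u $ i $ j * vector [1, cis x + cis y, cis (x + y)] $ j)"
  have unit: "cos z * cos z + sin z * sin z = 1" for z :: real
    by (simp flip: power2_eq_square)
  \<comment> \<open>Real and imaginary parts of the identity that \<open>e^(i(x+y))\<close> times
    the conjugate of \<open>e^(ix) + e^(iy)\<close> is \<open>e^(ix) + e^(iy)\<close> again.\<close>
  have rot: "cos (x + y) * (cos x + cos y) + sin (x + y) * (sin x + sin y) = cos x + cos y"
    "sin (x + y) * (cos x + cos y) - cos (x + y) * (sin x + sin y) = sin x + sin y"
    using cos_diff[of "x + y" x] cos_diff[of "x + y" y] sin_diff[of "x + y" x] sin_diff[of "x + y" y]
    by (simp_all add: algebra_simps)
  have "S \<in> \<real>\<^sub>\<ge>\<^sub>0"
    using psd unfolding pos_semidef_def S_def by blast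
  then have "0 \<le> Re S"
    by (simp add: complex_nonneg_Reals_iff)
  also have "Re S = 2 * (cos (x - y) + 2) * form (eps p) (toeplitz a b c d u)"
  proof -
    define D where "D = cos (x - y) + 2"
    have "D \<noteq> 0" using cos_add_2_pos[of "x - y"] by (simp add: D_def)
    have "Re S = u * (2 + (cos x + cos y)\<^sup>2 + (sin x + sin y)\<^sup>2)
        + 4 * (a * (cos x + cos y) + b * (sin x + sin y)) + 2 * (c * cos (x + y) + d * sin (x + y))"
      by (simp add: S_def sum_3 toeplitz_nth vector_3 power2_eq_square) (use unit[of "x + y"] rot in algebra)
    also have "2 + (cos x + cos y)\<^sup>2 + (sin x + sin y)\<^sup>2 = 2 * D"
      unfolding D_def cos_diff using unit[of x] unit[of y] by algebra
    also have "u * (2 * D) + 4 * (a * (cos x + cos y) + b * (sin x + sin y))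
        + 2 * (c * cos (x + y) + d * sin (x + y)) = 2 * D * form (eps p) (toeplitz a b c d u)"
      using \<open>D \<noteq> 0\<close> unfolding p eps_abs D_def[symmetric]
      by (simp add: form_toeplitz vector_nth_4 field_simps)
    finally show ?thesis unfolding D_def .
  qed
  finally show "0 \<le> form (eps p) (toeplitz a b c d u)"
    using cos_add_2_pos[of "x - y"] by (simp add: zero_le_mult_iff)
qed

section \<open>Nonnegative trigonometric polynomials with a zero\<close>

text \<open>A negative value of \<open>q\<close> would persist on an interval, and there the factor
  would have to vanish identically, although its zeros are isolated.\<close>

lemma nonneg_cancel_one_plus_cos:
  fixes q :: "real \<Rightarrow> real"
  assumes "continuous_on UNIV q" and nonneg: "\<And>\<theta>. 0 \<le> (1 + cos (\<theta> - x)) * q \<theta>"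
  shows "0 \<le> q \<theta>"
proof (rule ccontr)
  assume "\<not> 0 \<le> q \<theta>"
  then have "\<theta> \<in> {\<theta>. q \<theta> < 0}" by simp
  moreover have "open {\<theta>. q \<theta> < 0}"
    by (rule open_Collect_less[OF assms(1) continuous_on_const])
  ultimately obtain e where e: "e > 0" "ball \<theta> e \<subseteq> {\<theta>. q \<theta> < 0}"
    by (metis openE)
  \<comment> \<open>Half the radius keeps \<open>\<theta> + h\<close> in the ball; the bound 1 keeps
    \<open>h\<close> below \<open>pi\<close>, where cosine is strictly decreasing.\<close>
  define h where "h = min (e / 2) 1"
  have h: "0 < h" "h < e" "h \<le> 1" using e(1) by (auto simp: h_def)
  have *: "cos (\<phi> - x) = -1" if "\<phi> \<in> ball \<theta> e" for \<phi>
  proof -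
    have "q \<phi> < 0" using that e(2) by auto
    with nonneg[of \<phi>] have "1 + cos (\<phi> - x) \<le> 0"
      by (simp add: zero_le_mult_iff)
    then show ?thesis using cos_ge_minus_one[of "\<phi> - x"] by linarith
  qed
  have cos1: "cos (\<theta> - x) = -1" and cos2: "cos (\<theta> - x + h) = -1"
    using *[of \<theta>] *[of "\<theta> + h"] h e(1) by (auto simp: dist_real_def algebra_simps)
  from cos1 have "sin (\<theta> - x) = 0"
    using sin_cos_squared_add[of "\<theta> - x"] by simp
  with cos1 cos2 have "cos h = cos 0"
    by (simp add: cos_add)
  moreover have "cos h < cos 0"
    using h pi_gt3 by (intro cos_monotone_0_pi) auto
  ultimately show False by simp
qed

text \<open>
  Nonnegativity forces a double zero; it is split off at the origin after a rotation of the circle.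
\<close>

lemma trig_poly_factor:
  assumes nonneg: "\<And>\<theta>. 0 \<le> trig_poly w \<theta>" and zero: "trig_poly w (x + pi) = 0"
  obtains y A R where "0 \<le> R" "R \<le> A"
    "\<And>\<theta>. trig_poly w \<theta> = (1 + cos (\<theta> - x)) * (A + R * cos (\<theta> - y))"
    "A + R * cos (x - y) / 2 = 1"
proof -
  define \<alpha> where "\<alpha> = x + pi"
  define a where "a = w $ 1 * cos \<alpha> + w $ 2 * sin \<alpha>"
  define b where "b = w $ 2 * cos \<alpha> - w $ 1 * sin \<alpha>"
  define c where "c = w $ 3 * cos (2 * \<alpha>) + w $ 4 * sin (2 * \<alpha>)"
  define d where "d = w $ 4 * cos (2 * \<alpha>) - w $ 3 * sin (2 * \<alpha>)"
  have rot: "trig_poly w (\<alpha> + t) = a * cos t + b * sin t + c * cos (2 * t) + d * sin (2 * t) + 1" for t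
    unfolding trig_poly_def a_def b_def c_def d_def distrib_left[of 2 \<alpha> t] cos_add sin_add by algebra
  have "a + c + 1 = 0"
    using rot[of 0] zero by (simp add: \<alpha>_def)
  \<comment> \<open>The zero is a minimum, so the derivative there vanishes.\<close>
  moreover have "b + 2 * d = 0"
  proof -
    have "((\<lambda>t. trig_poly w (\<alpha> + t)) has_real_derivative (b + 2 * d)) (at 0)"
      unfolding rot by (auto intro!: derivative_eq_intros)
    then show ?thesis
      by (rule DERIV_local_min[of _ _ _ 1]) (use nonneg zero in \<open>auto simp: \<alpha>_def\<close>)
  qed
  ultimately have ab: "a = - 1 - c" "b = - 2 * d" by auto
  \<comment> \<open>Dividing by \<open>1 - cos t\<close> leaves
    \<open>(1 - c) - 2 * c * cos t - 2 * d * sin t\<close>; its oscillating part is brought to the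
    amplitude-phase form \<open>R * cos (t - z)\<close>.\<close>
  define R where "R = sqrt ((2 * c)\<^sup>2 + (2 * d)\<^sup>2)"
  define A where "A = 1 - c"
  obtain z where z: "- 2 * c = R * cos z" "- 2 * d = R * sin z"
  proof (cases "R = 0")
    case True
    then have "c = 0" "d = 0"
      using sum_power2_eq_zero_iff[of "2 * c" "2 * d"] unfolding R_def by auto
    then show ?thesis using True that by simp
  next
    case False
    have R2: "(2 * c)\<^sup>2 + (2 * d)\<^sup>2 = R\<^sup>2" unfolding R_def by simp
    have "((2 * c)\<^sup>2 + (2 * d)\<^sup>2) / R\<^sup>2 = 1"
      unfolding R2 using False by simp
    then have "(- 2 * c / R)\<^sup>2 + (- 2 * d / R)\<^sup>2 = 1"
      by (simp add: power_divide add_divide_distrib)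
    then obtain t where "- 2 * c / R = cos t" "- 2 * d / R = sin t"
      by (rule sincos_total_2pi)
    then show ?thesis
      using False by (intro that[of t]) (simp_all only: divide_eq_eq not_False_eq_True if_True mult.commute[of R])
  qed
  define y where "y = z + \<alpha>"
  have fac: "trig_poly w \<theta> = (1 + cos (\<theta> - x)) * (A + R * cos (\<theta> - y))" for \<theta>
  proof -
    define t where "t = \<theta> - \<alpha>"
    have "trig_poly w \<theta> = a * cos t + b * sin t + c * cos (2 * t) + d * sin (2 * t) + 1"
      using rot[of t] by (simp add: t_def)
    also have "\<dots> = (1 - cos t) * (A + (- 2 * c) * cos t + (- 2 * d) * sin t)"
      unfolding ab A_def cos_double_cos sin_double by algebra
    also have "\<dots> = (1 - cos t) * (A + R * cos (t - z))"
      unfolding z cos_diff by algebra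
    also have "cos t = - cos (\<theta> - x)"
      by (simp add: t_def \<alpha>_def cos_diff cos_add sin_add algebra_simps)
    finally show ?thesis
      by (simp add: t_def y_def algebra_simps)
  qed
  have "0 \<le> A + R * cos (\<theta> - y)" for \<theta>
  proof (rule nonneg_cancel_one_plus_cos[where x = x and q = "\<lambda>\<theta>. A + R * cos (\<theta> - y)"])
    show "continuous_on UNIV (\<lambda>\<theta>. A + R * cos (\<theta> - y))" by (intro continuous_intros)
    show "0 \<le> (1 + cos (\<theta> - x)) * (A + R * cos (\<theta> - y))" for \<theta>
      using nonneg[of \<theta>] unfolding fac .
  qed
  \<comment> \<open>At this angle the second factor takes its minimum \<open>A - R\<close>.\<close>
  from this[of "y + pi"] have "R \<le> A" by simp
  moreover have "0 \<le> R" by (simp add: R_def)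
  \<comment> \<open>The left side is the mean value of the product, hence the constant term 1 of the
    polynomial.\<close>
  moreover have "A + R * cos (x - y) / 2 = 1"
  proof -
    have "cos (x - y) = - cos z"
      by (simp add: y_def \<alpha>_def cos_diff cos_add sin_add algebra_simps)
    then show ?thesis
      using z(1) by (simp add: A_def)
  qed
  ultimately show ?thesis using fac that by blast
qed

lemma trig_poly_zero_imp_beta:
  assumes "\<And>\<theta>. 0 \<le> trig_poly w \<theta>" and "trig_poly w (x + pi) = 0"
  obtains y s where "0 \<le> s" "s \<le> 1" "w = beta (abs_circle x, abs_circle y, s)"
proof -
  obtain y A R where AR: "0 \<le> R" "R \<le> A" and norm: "A + R * cos (x - y) / 2 = 1"
    and fac: "\<And>\<theta>. trig_poly w \<theta> = (1 + cos (\<theta> - x)) * (A + R * cos (\<theta> - y))"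
    using trig_poly_factor[OF assms] by metis
  \<comment> \<open>Since \<open>A + R * cos t\<close> is
    \<open>(A + R) / 2 * (1 + cos t) + (A - R) / 2 * (1 - cos t)\<close>, the weights are these
    coefficients divided by the normalizing factors of the two \<open>eps\<close> polynomials;
    \<open>norm\<close> makes them add up to 1.\<close>
  define s where "s = (A + R) * (2 + cos (x - y)) / 4"
  have s': "1 - s = (A - R) * (2 - cos (x - y)) / 4"
    using norm by (simp add: s_def field_simps)
  have cos_pi: "cos (x - (y + pi)) = - cos (x - y)" "cos (\<theta> - (y + pi)) = - cos (\<theta> - y)" for \<theta>
    by (simp_all add: cos_diff cos_add sin_add)
  have pos: "2 + cos (x - y) > 0" "2 - cos (x - y) > 0"
    using cos_ge_minus_one[of "x - y"] cos_le_one[of "x - y"] by linarith+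
  have "0 \<le> s" "0 \<le> 1 - s"
    unfolding s' using AR pos by (auto simp: s_def)
  moreover have "w = beta (abs_circle x, abs_circle y, s)"
  proof (rule trig_poly_inject)
    fix \<theta>
    have "s * (2 * (1 + cos (\<theta> - x)) * (1 + cos (\<theta> - y)) / (cos (x - y) + 2))
        = (1 + cos (\<theta> - x)) * (1 + cos (\<theta> - y)) * (A + R) / 2"
      using pos by (simp add: s_def field_simps)
    moreover have "(1 - s) * (2 * (1 + cos (\<theta> - x)) * (1 + - cos (\<theta> - y)) / (- cos (x - y) + 2))
        = (1 + cos (\<theta> - x)) * (1 + - cos (\<theta> - y)) * (A - R) / 2"
      using pos by (simp add: s' field_simps)
    ultimately show "trig_poly w \<theta> = trig_poly (beta (abs_circle x, abs_circle y, s)) \<theta>"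
      unfolding beta_def prod.case trig_poly_affine plus_circle.abs_eq trig_poly_eps cos_pi fac
      by (simp only:) (simp add: field_simps)
  qed
  ultimately show ?thesis using that by simp
qed

section \<open>States as nonnegative trigonometric polynomials\<close>

lemma convex_state_space: "convex state_space"
proof (rule convexI)
  fix v w :: "real^4" and s t :: real
  assume vw: "v \<in> state_space" "w \<in> state_space" and st: "0 \<le> s" "0 \<le> t" "s + t = 1"
  have "form (s *\<^sub>R v + t *\<^sub>R w) (toeplitz a b c d u) =
      s * form v (toeplitz a b c d u) + t * form w (toeplitz a b c d u)" for a b c d u
    unfolding form_toeplitz using st(3) by simp algebra
  with vw st show "s *\<^sub>R v + t *\<^sub>R w \<in> state_space"
    unfolding state_space_iff_form by simp
qed

lemma beta_in_state_space:
  assumes "0 \<le> s" "s \<le> 1"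
  shows "beta (x, y, s) \<in> state_space"
  using convexD[OF convex_state_space eps_in_state_space eps_in_state_space, of s "1 - s"] assms
  by (simp add: beta_def)

lemma trig_poly_attains_min: obtains \<alpha> where "\<And>\<theta>. trig_poly w \<alpha> \<le> trig_poly w \<theta>"
proof -
  have "{0..2 * pi} \<noteq> {}" by simp
  from continuous_attains_inf[OF compact_Icc this continuous_trig_poly, of w]
  obtain \<alpha> where \<alpha>: "\<And>\<theta>. \<theta> \<in> {0..2 * pi} \<Longrightarrow> trig_poly w \<alpha> \<le> trig_poly w \<theta>"
    by blast
  have "trig_poly w \<alpha> \<le> trig_poly w \<theta>" for \<theta>
  proof -
    define n where "n = \<lfloor>\<theta> / (2 * pi)\<rfloor>"
    have "of_int n \<le> \<theta> / (2 * pi)" "\<theta> / (2 * pi) < of_int n + 1"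
      unfolding n_def by linarith+
    then have "\<theta> + of_int (- n) * (2 * pi) \<in> {0..2 * pi}"
      by (simp add: field_simps)
    from \<alpha>[OF this] show ?thesis unfolding trig_poly_periodic .
  qed
  then show ?thesis by (rule that)
qed

lemma state_space_eq: "state_space = {w. \<forall>\<theta>. 0 \<le> trig_poly w \<theta>}"
proof (intro equalityI subsetI)
  fix w assume "w \<in> {w. \<forall>\<theta>. 0 \<le> trig_poly w \<theta>}"
  then have nonneg: "0 \<le> trig_poly w \<theta>" for \<theta> by simp
  obtain \<alpha> where \<alpha>: "\<And>\<theta>. trig_poly w \<alpha> \<le> trig_poly w \<theta>"
    using trig_poly_attains_min[of w] by blast
  define m where "m = trig_poly w \<alpha>"
  show "w \<in> state_space"
  proof (cases "m < 1")
    case True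
    \<comment> \<open>Subtracting the minimum and rescaling restores the constant term 1. Conversely
      \<open>w\<close> is the convex combination of \<open>v\<close> and the state 0 with weights
      \<open>1 - m\<close> and \<open>m\<close>.\<close>
    define v where "v = (1 / (1 - m)) *\<^sub>R w"
    have v: "trig_poly v \<theta> = (trig_poly w \<theta> - m) / (1 - m)" for \<theta>
      using True by (simp add: trig_poly_eq_inner v_def field_simps)
    have "0 \<le> trig_poly v \<theta>" for \<theta>
      using \<alpha> True by (simp add: v m_def)
    moreover have "trig_poly v ((\<alpha> - pi) + pi) = 0"
      by (simp add: v m_def)
    ultimately have "v \<in> state_space"
      by (metis trig_poly_zero_imp_beta beta_in_state_space)
    from convexD[OF convex_state_space this zero_in_state_space, of "1 - m" m] nonneg[of \<alpha>] True
    show ?thesis by (simp add: m_def v_def)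
  next
    case False
    then have ge: "1 \<le> trig_poly w \<theta>" for \<theta>
      using \<alpha>[of \<theta>] by (simp add: m_def)
    \<comment> \<open>The average over four quarter turns is 1, so a polynomial that is everywhere
      at least 1 is constant.\<close>
    have "w = 0"
    proof (rule trig_poly_inject)
      fix \<theta>
      have "trig_poly w \<theta> + trig_poly w (\<theta> + pi / 2) + trig_poly w (\<theta> + pi)
          + trig_poly w (\<theta> - pi / 2) = 4"
        by (simp add: trig_poly_def distrib_left right_diff_distrib cos_add sin_add cos_diff sin_diff)
      with ge[of \<theta>] ge[of "\<theta> + pi / 2"] ge[of "\<theta> + pi"] ge[of "\<theta> - pi / 2"]
      show "trig_poly w \<theta> = trig_poly 0 \<theta>"
        by (simp add: trig_poly_def[of 0])
    qed
    then show ?thesis by (simp add: zero_in_state_space)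
  qed
qed (use trig_poly_nonneg_if_state in auto)

section \<open>Boundary and extreme points\<close>

lemma closed_state_space: "closed state_space"
proof -
  have "state_space = (\<Inter>\<theta>. {w. 0 \<le> w \<bullet> vector [cos \<theta>, sin \<theta>, cos (2 * \<theta>), sin (2 * \<theta>)] + 1})"
    by (auto simp: state_space_eq trig_poly_eq_inner)
  moreover have "closed \<dots>"
    by (intro closed_INT ballI closed_Collect_le continuous_intros)
  ultimately show ?thesis by simp
qed

lemma norm_moment_vector:
  "(norm (vector [cos \<theta>, sin \<theta>, cos (2 * \<theta>), sin (2 * \<theta>)] :: real^4))\<^sup>2 = 2"
  unfolding power2_norm_eq_inner
  using sin_cos_squared_add3[of \<theta>] sin_cos_squared_add3[of "2 * \<theta>"]
  by (simp only: inner_vec_def sum_4 vector_nth_4 inner_real_def)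

lemma frontier_state_space_iff:
  "w \<in> frontier state_space \<longleftrightarrow> w \<in> state_space \<and> (\<exists>\<alpha>. trig_poly w \<alpha> = 0)"
proof -
  define e where "e = (\<lambda>\<theta>. vector [cos \<theta>, sin \<theta>, cos (2 * \<theta>), sin (2 * \<theta>)] :: real^4)"
  have inner: "trig_poly v \<theta> = v \<bullet> e \<theta> + 1" for v \<theta>
    by (simp add: trig_poly_eq_inner e_def)
  have norm_e: "(norm (e \<theta>))\<^sup>2 = 2" for \<theta>
    unfolding e_def by (rule norm_moment_vector)
  have norm_e_le: "norm (e \<theta>) \<le> 2" for \<theta>
    by (rule power2_le_imp_le) (simp_all add: norm_e)
  have "w \<in> interior state_space \<longleftrightarrow> (\<forall>\<alpha>. trig_poly w \<alpha> \<noteq> 0)" if w: "w \<in> state_space"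
  proof
    assume "w \<in> interior state_space"
    then obtain r where r: "r > 0" "ball w r \<subseteq> state_space"
      by (auto simp: mem_interior)
    show "\<forall>\<alpha>. trig_poly w \<alpha> \<noteq> 0"
    proof (intro allI notI)
      fix \<alpha> assume zero: "trig_poly w \<alpha> = 0"
      \<comment> \<open>Moving against the moment vector lowers the value at \<open>\<alpha>\<close>
        by \<open>r / 4 * 2\<close>, while the displacement has norm at most
        \<open>r / 2\<close>.\<close>
      define v where "v = w - (r / 4) *\<^sub>R e \<alpha>"
      have "r / 4 * norm (e \<alpha>) \<le> r / 4 * 2"
        using r(1) by (intro mult_left_mono norm_e_le) auto
      then have "norm ((r / 4) *\<^sub>R e \<alpha>) < r"
        using r(1) by simp
      then have "v \<in> state_space"
        using r(2) by (auto simp: v_def dist_norm)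
      then have "0 \<le> trig_poly v \<alpha>"
        by (rule trig_poly_nonneg_if_state)
      moreover have "trig_poly v \<alpha> = - (r / 2)"
        using zero norm_e[of \<alpha>] by (simp add: inner v_def inner_diff_left dot_square_norm)
      ultimately show False using r(1) by simp
    qed
  next
    assume nz: "\<forall>\<alpha>. trig_poly w \<alpha> \<noteq> 0"
    obtain \<alpha> where \<alpha>: "\<And>\<theta>. trig_poly w \<alpha> \<le> trig_poly w \<theta>"
      using trig_poly_attains_min[of w] by blast
    define m where "m = trig_poly w \<alpha>"
    have "m > 0"
      using nz trig_poly_nonneg_if_state[OF w, of \<alpha>] by (simp add: m_def less_le)
    \<comment> \<open>Moment vectors have norm at most 2, so a perturbation shorter than
      \<open>m / 2\<close> changes the polynomial by at most \<open>m\<close> at every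
      angle.\<close>
    moreover have "ball w (m / 2) \<subseteq> state_space"
    proof
      fix v assume "v \<in> ball w (m / 2)"
      then have dist: "norm (w - v) < m / 2" by (simp add: dist_norm)
      have "0 \<le> trig_poly v \<theta>" for \<theta>
      proof -
        have "norm (w - v) * norm (e \<theta>) \<le> m"
          using dist \<open>m > 0\<close> mult_mono[OF _ norm_e_le, of "norm (w - v)" "m / 2" \<theta>] by simp
        then have "(w - v) \<bullet> e \<theta> \<le> m"
          using norm_cauchy_schwarz[of "w - v" "e \<theta>"] by linarith
        with \<alpha>[of \<theta>] show ?thesis
          unfolding m_def inner inner_diff_left by linarith
      qed
      then show "v \<in> state_space" by (simp add: state_space_eq)
    qed
    ultimately show "w \<in> interior state_space"
      unfolding mem_interior by (meson half_gt_zero)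
  qed
  then show ?thesis
    using closed_state_space by (auto simp: frontier_def)
qed

text \<open>Both endpoints of a segment vanish at the antipode of \<open>x\<close>, so the whole
  segment does; the converse is the factorization at a zero.\<close>

lemma beta_image_eq_frontier: "beta ` (UNIV \<times> UNIV \<times> {0..1}) = frontier state_space"
proof (intro equalityI subsetI)
  fix w assume "w \<in> beta ` (UNIV \<times> UNIV \<times> {0..1})"
  then obtain x' y' s where w': "w = beta (x', y', s)" and s: "0 \<le> s" "s \<le> 1"
    by auto
  obtain x where x: "x' = abs_circle x" by (rule circle_surj)
  obtain y where y: "y' = abs_circle y" by (rule circle_surj)
  note w = w'[unfolded x y]
  have "trig_poly (eps (abs_circle x, abs_circle z)) (x + pi) = 0" for z
    unfolding trig_poly_eps_eq_0_iff by simp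
  then have "trig_poly w (x + pi) = 0"
    by (simp add: w beta_def trig_poly_affine plus_circle.abs_eq)
  moreover have "w \<in> state_space"
    unfolding w using s by (rule beta_in_state_space)
  ultimately show "w \<in> frontier state_space"
    unfolding frontier_state_space_iff by blast
next
  fix w assume "w \<in> frontier state_space"
  then obtain \<alpha> where w: "w \<in> state_space" "trig_poly w \<alpha> = 0"
    unfolding frontier_state_space_iff by blast
  then have zero: "trig_poly w ((\<alpha> - pi) + pi) = 0" by simp
  obtain y s where "0 \<le> s" "s \<le> 1" "w = beta (abs_circle (\<alpha> - pi), abs_circle y, s)"
    using trig_poly_zero_imp_beta[OF trig_poly_nonneg_if_state[OF w(1)] zero] .
  then show "w \<in> beta ` (UNIV \<times> UNIV \<times> {0..1})" by auto
qed

section \<open>Extreme points\<close>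

text \<open>Domination forces a zero of \<open>w\<close> at \<open>x + pi\<close>, so
  \<open>w\<close> has the factor \<open>1 + cos (\<theta> - x)\<close>. Once this is cancelled,
  domination at \<open>y + pi\<close> forces \<open>R = A\<close> and the phase \<open>y\<close>,
  and the constant term fixes the scale. Cancelling first also covers the case that \<open>x\<close>
  and \<open>y\<close> are the same point.\<close>

lemma eq_eps_if_dominated:
  assumes w: "w \<in> state_space" and "0 < c"
    and dom: "\<And>\<theta>. c * trig_poly w \<theta> \<le> trig_poly (eps (abs_circle x, abs_circle y)) \<theta>"
  shows "w = eps (abs_circle x, abs_circle y)"
proof -
  note nonneg = trig_poly_nonneg_if_state[OF w]
  define D where "D = cos (x - y) + 2"
  have "D > 0" unfolding D_def by (rule cos_add_2_pos)
  have "trig_poly (eps (abs_circle x, abs_circle y)) (x + pi) = 0"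
    by (simp add: trig_poly_eps_eq_0_iff)
  with dom[of "x + pi"] nonneg[of "x + pi"] \<open>0 < c\<close> have "trig_poly w (x + pi) = 0"
    by (simp add: mult_le_0_iff)
  then obtain z A R where AR: "0 \<le> R" "R \<le> A" and norm: "A + R * cos (x - z) / 2 = 1"
    and fac: "\<And>\<theta>. trig_poly w \<theta> = (1 + cos (\<theta> - x)) * (A + R * cos (\<theta> - z))"
    using trig_poly_factor[OF nonneg] by metis
  define q where "q = (\<lambda>\<theta>. 2 * (1 + cos (\<theta> - y)) / D - c * (A + R * cos (\<theta> - z)))"
  have "0 \<le> q \<theta>" for \<theta>
  proof (rule nonneg_cancel_one_plus_cos[where x = x and q = q])
    show "continuous_on UNIV q"
      unfolding q_def using \<open>D > 0\<close> by (intro continuous_intros) auto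
    show "0 \<le> (1 + cos (\<theta> - x)) * q \<theta>" for \<theta>
      using dom[of \<theta>] unfolding fac trig_poly_eps D_def[symmetric] q_def by (simp add: algebra_simps)
  qed
  from this[of "y + pi"] have "c * (A + R * cos (y + pi - z)) \<le> 0"
    by (simp add: q_def)
  moreover have "cos (y + pi - z) = - cos (y - z)"
    by (simp add: cos_diff cos_add sin_add)
  ultimately have "A \<le> R * cos (y - z)"
    using \<open>0 < c\<close> by (simp add: mult_le_0_iff)
  moreover have "R * cos (y - z) \<le> R"
    using AR(1) by (simp add: mult_left_le)
  ultimately have "R = A" "R * cos (y - z) = R"
    using AR by linarith+
  moreover have "A \<noteq> 0"
    using norm \<open>R = A\<close> by auto
  ultimately have "abs_circle y = abs_circle z"
    by (simp add: abs_circle_eq_iff_cos_diff)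
  then have yz: "cos (\<theta> - z) = cos (\<theta> - y)" for \<theta>
    unfolding abs_circle_eq_iff cos_diff by simp
  moreover have "cos (x - z) = cos (x - y)" by (rule yz)
  ultimately have A: "A = 2 / D"
    using norm \<open>R = A\<close> \<open>D > 0\<close> by (simp add: D_def field_simps)
  show ?thesis
  proof (rule trig_poly_inject)
    show "trig_poly w \<theta> = trig_poly (eps (abs_circle x, abs_circle y)) \<theta>" for \<theta>
      unfolding fac trig_poly_eps D_def[symmetric] yz \<open>R = A\<close> A by (simp add: algebra_simps add_divide_distrib)
  qed
qed

text \<open>If \<open>eps\<close> lies inside a segment of states, each endpoint times its weight is
  dominated by it. Conversely, an extreme point lies on the boundary, hence on a segment given by
  \<open>beta\<close>, and can only be an endpoint.\<close>

lemma extreme_states_eq: "extreme_states = range eps"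
proof (intro equalityI subsetI)
  fix w assume "w \<in> range eps"
  then obtain x y where w: "w = eps (abs_circle x, abs_circle y)"
    by (metis circle_surj surj_pair imageE)
  show "w \<in> extreme_states"
    unfolding extreme_states_def mem_Collect_eq extreme_point_of_def
  proof (intro conjI ballI notI)
    show "w \<in> state_space" unfolding w by (rule eps_in_state_space)
    fix a b assume ab: "a \<in> state_space" "b \<in> state_space" "w \<in> open_segment a b"
    then obtain u where u: "a \<noteq> b" "0 < u" "u < 1" "w = (1 - u) *\<^sub>R a + u *\<^sub>R b"
      by (auto simp: in_segment)
    have mix: "trig_poly w \<theta> = u * trig_poly b \<theta> + (1 - u) * trig_poly a \<theta>" for \<theta>
      unfolding u(4) by (subst add.commute) (rule trig_poly_affine)
    have "a = w"
      unfolding w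
    proof (rule eq_eps_if_dominated)
      show "(1 - u) * trig_poly a \<theta> \<le> trig_poly (eps (abs_circle x, abs_circle y)) \<theta>" for \<theta>
        using mix[of \<theta>] trig_poly_nonneg_if_state[OF ab(2), of \<theta>] u(2) by (simp add: w)
    qed (use ab u in auto)
    moreover have "b = w"
      unfolding w
    proof (rule eq_eps_if_dominated)
      show "u * trig_poly b \<theta> \<le> trig_poly (eps (abs_circle x, abs_circle y)) \<theta>" for \<theta>
        using mix[of \<theta>] trig_poly_nonneg_if_state[OF ab(1), of \<theta>] u(3) by (simp add: w)
    qed (use ab u in auto)
    ultimately show False using u(1) by simp
  qed
next
  fix w assume "w \<in> extreme_states"
  then have ext: "w extreme_point_of state_space" by (simp add: extreme_states_def)
  have "eps (abs_circle 0, abs_circle 0) \<noteq> eps (abs_circle 0, abs_circle pi)"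
    by (simp add: eps_eq_iff abs_circle_eq_iff)
  then have "state_space \<noteq> {w}"
    using eps_in_state_space by (metis singletonD)
  then have "w \<notin> interior state_space"
    using ext extreme_point_not_in_interior by blast
  with ext have "w \<in> frontier state_space"
    by (auto simp: frontier_def extreme_point_of_def intro: closure_subset[THEN subsetD])
  then obtain x y s where s: "0 \<le> s" "s \<le> 1" and "w = beta (x, y, s)"
    unfolding beta_image_eq_frontier[symmetric] by auto
  then have w: "w = s *\<^sub>R eps (x, y) + (1 - s) *\<^sub>R eps (x, y + abs_circle pi)"
    by (simp add: beta_def)
  have "w \<in> {eps (x, y), eps (x, y + abs_circle pi)}"
  proof (rule ccontr)
    assume *: "w \<notin> {eps (x, y), eps (x, y + abs_circle pi)}"
    have "w \<in> closed_segment (eps (x, y + abs_circle pi)) (eps (x, y))"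
      unfolding in_segment w using s by (intro exI[of _ s]) (auto simp: add.commute)
    with * have "w \<in> open_segment (eps (x, y + abs_circle pi)) (eps (x, y))"
      by (auto simp: open_segment_def)
    then show False
      using ext eps_in_state_space unfolding extreme_point_of_def by blast
  qed
  then show "w \<in> range eps" by auto
qed

section \<open>The discriminant hypersurface\<close>

text \<open>
  The classical expression of the discriminant of a quartic by its two invariants, which
  makes it easy to differentiate.
\<close>

lemma disc_poly_eq:
  "disc_poly w =
    ((72 * ((w $ 3)\<^sup>2 + (w $ 4)\<^sup>2) + 9 * ((w $ 2)\<^sup>2 + (w $ 1)\<^sup>2) - 8
      - 27 * (w $ 3 * ((w $ 1)\<^sup>2 - (w $ 2)\<^sup>2) + 2 * w $ 4 * w $ 1 * w $ 2))\<^sup>2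
    - (4 + 12 * ((w $ 3)\<^sup>2 + (w $ 4)\<^sup>2) - 3 * ((w $ 2)\<^sup>2 + (w $ 1)\<^sup>2)) ^ 3) / 27"
  unfolding disc_poly_def Let_def by (simp add: power2_eq_square power3_eq_cube eval_nat_numeral algebra_simps)

text \<open>The polynomial is \<open>(Q^2 - P^3) / 27\<close>. At \<open>eps p\<close> one has
  \<open>P = h^2\<close>, \<open>Q = h^3\<close> and \<open>2 * Q' = 3 * h * P'\<close>, so the
  value and the differential both cancel.\<close>

lemma eps_in_disc_singular_set: "eps p \<in> disc_singular_set"
proof -
  obtain x y where p: "p = (abs_circle x, abs_circle y)"
    by (metis circle_surj surj_pair)
  define w where "w = eps p"
  define D where "D = cos (x - y) + 2"
  define i where "i = 1 / D"
  \<comment> \<open>Using \<open>D * i = 1\<close>, the value of \<open>P\<close> becomes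
    \<open>4 * (3 - D)^2 * i^2\<close>; this is the square root whose cube is
    \<open>Q\<close>.\<close>
  define h where "h = 2 * (3 - D) * i"
  have Di: "D * i = 1"
    using cos_add_2_pos[of "x - y"] by (simp add: D_def i_def)
  define P where "P = (\<lambda>v :: real^4. 4 + 12 * ((v $ 3)\<^sup>2 + (v $ 4)\<^sup>2) - 3 * ((v $ 2)\<^sup>2 + (v $ 1)\<^sup>2))"
  define Q where "Q = (\<lambda>v :: real^4. 72 * ((v $ 3)\<^sup>2 + (v $ 4)\<^sup>2) + 9 * ((v $ 2)\<^sup>2 + (v $ 1)\<^sup>2) - 8
      - 27 * (v $ 3 * ((v $ 1)\<^sup>2 - (v $ 2)\<^sup>2) + 2 * v $ 4 * v $ 1 * v $ 2))"
  define P' where "P' = (\<lambda>v :: real^4. 24 * (w $ 3 * v $ 3 + w $ 4 * v $ 4) - 6 * (w $ 2 * v $ 2 + w $ 1 * v $ 1))"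
  define Q' where "Q' = (\<lambda>v :: real^4.
      (18 * w $ 1 - 54 * (w $ 3 * w $ 1 + w $ 4 * w $ 2)) * v $ 1
    + (18 * w $ 2 - 54 * (w $ 4 * w $ 1 - w $ 3 * w $ 2)) * v $ 2
    + (144 * w $ 3 - 27 * ((w $ 1)\<^sup>2 - (w $ 2)\<^sup>2)) * v $ 3
    + (144 * w $ 4 - 54 * (w $ 1 * w $ 2)) * v $ 4)"
  have nth: "((\<lambda>v. v $ k) has_derivative (\<lambda>v. v $ k)) (at w)" for k :: 4
    by (rule bounded_linear_imp_has_derivative[OF bounded_linear_vec_nth])
  have P': "(P has_derivative P') (at w)"
    unfolding P_def P'_def
    by (auto intro!: derivative_eq_intros nth simp: algebra_simps)
  have Q': "(Q has_derivative Q') (at w)"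
    unfolding Q_def Q'_def
    by (auto intro!: derivative_eq_intros nth simp: algebra_simps power2_eq_square)
  define a where "a = cos (x + y)"
  define b where "b = sin (x + y)"
  define C where "C = cos x + cos y"
  define S where "S = sin x + sin y"
  have w_nth: "w $ 1 = 2 * C * i" "w $ 2 = 2 * S * i" "w $ 3 = a * i" "w $ 4 = b * i"
    by (simp_all add: w_def p eps_abs vector_nth_4 D_def i_def a_def b_def C_def S_def)
  \<comment> \<open>Again \<open>e^(i(x+y))\<close> times the conjugate of \<open>C + i S\<close> is
    \<open>C + i S\<close>, with \<open>i\<close> the imaginary unit.\<close>
  have rot: "a * C + b * S = C" "b * C - a * S = S"
    unfolding a_def b_def C_def S_def
    using cos_diff[of "x + y" x] cos_diff[of "x + y" y] sin_diff[of "x + y" x] sin_diff[of "x + y" y]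
    by (simp_all add: algebra_simps)
  have ab: "a\<^sup>2 + b\<^sup>2 = 1"
    by (simp add: a_def b_def)
  have CS: "C\<^sup>2 + S\<^sup>2 = 2 * (D - 1)"
    unfolding C_def S_def D_def cos_diff
    using sin_cos_squared_add[of x] sin_cos_squared_add[of y] by algebra
  have "w $ 3 * w $ 1 + w $ 4 * w $ 2 = 2 * i * i * (a * C + b * S)"
    "w $ 4 * w $ 1 - w $ 3 * w $ 2 = 2 * i * i * (b * C - a * S)"
    unfolding w_nth by (simp_all add: algebra_simps)
  then have r1: "w $ 3 * w $ 1 + w $ 4 * w $ 2 = w $ 1 * i" "w $ 4 * w $ 1 - w $ 3 * w $ 2 = w $ 2 * i"
    unfolding rot by (simp_all add: w_nth)
  \<comment> \<open>With \<open>rot\<close>, these say that the square of the complex number with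
    parts \<open>C\<close>, \<open>S\<close> is \<open>C^2 + S^2\<close> times the one with parts
    \<open>a\<close>, \<open>b\<close>.\<close>
  have "C * (a * C + b * S) - S * (b * C - a * S) = a * (C\<^sup>2 + S\<^sup>2)"
    "C * (b * C - a * S) + S * (a * C + b * S) = b * (C\<^sup>2 + S\<^sup>2)"
    by (simp_all add: power2_eq_square algebra_simps)
  then have r2: "(w $ 1)\<^sup>2 - (w $ 2)\<^sup>2 = 8 * (D - 1) * i * w $ 3" "w $ 1 * w $ 2 = 4 * (D - 1) * i * w $ 4"
    unfolding rot CS w_nth by - algebra+
  have "(w $ 3)\<^sup>2 + (w $ 4)\<^sup>2 = (a\<^sup>2 + b\<^sup>2) * i\<^sup>2"
    "(w $ 2)\<^sup>2 + (w $ 1)\<^sup>2 = 4 * (C\<^sup>2 + S\<^sup>2) * i\<^sup>2"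
    unfolding w_nth by - algebra+
  then have r3: "(w $ 3)\<^sup>2 + (w $ 4)\<^sup>2 = i\<^sup>2" "(w $ 2)\<^sup>2 + (w $ 1)\<^sup>2 = 8 * (D - 1) * i\<^sup>2"
    unfolding CS ab by simp_all
  txt \<open>
    The point lies on the locus where the quartic is a square, and there both invariants and
    their differentials are related through the single scalar \<open>h\<close>.
  \<close>
  have Pw: "P w = h\<^sup>2"
    unfolding P_def r3 h_def using Di by algebra
  have "w $ 3 * ((w $ 1)\<^sup>2 - (w $ 2)\<^sup>2) + 2 * w $ 4 * w $ 1 * w $ 2
      = w $ 3 * ((w $ 1)\<^sup>2 - (w $ 2)\<^sup>2) + 2 * w $ 4 * (w $ 1 * w $ 2)"
    by simp
  also have "\<dots> = 8 * (D - 1) * i * ((w $ 3)\<^sup>2 + (w $ 4)\<^sup>2)"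
    unfolding r2 by algebra
  also have "\<dots> = 8 * (D - 1) * i ^ 3"
    unfolding r3 by algebra
  finally have cubic: "w $ 3 * ((w $ 1)\<^sup>2 - (w $ 2)\<^sup>2) + 2 * w $ 4 * w $ 1 * w $ 2 = 8 * (D - 1) * i ^ 3" .
  have Qw: "Q w = h ^ 3"
    unfolding Q_def r3 cubic h_def using Di by algebra
  have grad: "18 * w $ 1 - 54 * (w $ 3 * w $ 1 + w $ 4 * w $ 2) = - 9 * h * w $ 1"
    "18 * w $ 2 - 54 * (w $ 4 * w $ 1 - w $ 3 * w $ 2) = - 9 * h * w $ 2"
    "144 * w $ 3 - 27 * ((w $ 1)\<^sup>2 - (w $ 2)\<^sup>2) = 36 * h * w $ 3"
    "144 * w $ 4 - 54 * (w $ 1 * w $ 2) = 36 * h * w $ 4"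
    unfolding r1 r2 h_def using Di by - algebra+
  have Q'_eq: "2 * Q' v = 3 * h * P' v" for v
    unfolding Q'_def P'_def grad by (simp add: algebra_simps)
  have disc: "disc_poly = (\<lambda>v. ((Q v)\<^sup>2 - P v ^ 3) / 27)"
    by (simp add: fun_eq_iff disc_poly_eq P_def Q_def)
  have "((\<lambda>v. ((Q v)\<^sup>2 - P v ^ 3) / 27) has_derivative
      (\<lambda>v. (2 * Q w * Q' v - 3 * (P w)\<^sup>2 * P' v) / 27)) (at w)"
    by (auto intro!: derivative_eq_intros P' Q' simp: fun_eq_iff field_simps)
  moreover have "2 * Q w * Q' v - 3 * (P w)\<^sup>2 * P' v = 0" for v
    unfolding Pw Qw using Q'_eq[of v] by algebra
  moreover have "(Q w)\<^sup>2 - P w ^ 3 = 0"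
    unfolding Pw Qw by algebra
  ultimately show ?thesis
    unfolding disc_singular_set_def gderiv_def w_def[symmetric] mem_Collect_eq disc by simp
qed

section \<open>The Moebius strip of extreme points\<close>

text \<open>
  The unordered pair \<open>{x, y}\<close> is described by its midpoint \<open>pi * s\<close> and its half distance
  \<open>pi * t\<close>; moving the midpoint once around by \<open>pi\<close> replaces \<open>t\<close> by \<open>1 - t\<close>.
\<close>

definition strip_map :: "real \<times> real \<Rightarrow> real^4" where
  "strip_map = (\<lambda>(s, t). eps (abs_circle (pi * (s + t)), abs_circle (pi * (s - t))))"

lemma continuous_abs_circle: "continuous_on S abs_circle"
  by (rule continuous_on_subset[of UNIV]) (simp_all add: continuous_on_open_vimage open_circle_def)

lemma continuous_strip_map: "continuous_on S strip_map"
proof -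
  have "continuous_on S (\<lambda>(s, t). (abs_circle (pi * (s + t)), abs_circle (pi * (s - t))))"
    unfolding case_prod_unfold
    by (intro continuous_on_Pair continuous_on_compose2[OF continuous_abs_circle[of UNIV]] continuous_intros) auto
  from continuous_on_compose2[OF continuous_eps this] show ?thesis
    by (simp add: strip_map_def case_prod_unfold)
qed

lemma abs_circle_eq_iff_int: "abs_circle x = abs_circle y \<longleftrightarrow> (\<exists>n. x = y + of_int n * (2 * pi))"
  unfolding circle.abs_eq_iff by (subst rcong_sym_iff) (rule rcong_altdef)

text \<open>The midpoint is reduced modulo \<open>pi\<close> by \<open>n\<close>; taking the same
  \<open>n\<close> off the half difference preserves both points modulo \<open>2 * pi\<close>. Then
  \<open>r\<close> is reduced modulo 2 into [-1, 1], and a negative \<open>r\<close> is removed by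
  swapping the points.\<close>

lemma strip_map_surj:
  obtains s t where "s \<in> {0..1}" "t \<in> {0..1}" "strip_map (s, t) = eps (abs_circle x, abs_circle y)"
proof -
  define u where "u = (x - y) / (2 * pi)"
  define n where "n = \<lfloor>(x + y) / (2 * pi)\<rfloor>"
  define s where "s = (x + y) / (2 * pi) - of_int n"
  define m where "m = round ((u - of_int n) / 2)"
  define r where "r = u - of_int n - 2 * of_int m"
  have s: "s \<in> {0..1}"
    unfolding s_def n_def by (simp; linarith)
  have "\<bar>of_int m - (u - of_int n) / 2\<bar> \<le> 1 / 2"
    unfolding m_def by (rule of_int_round_abs_le)
  then have r: "\<bar>r\<bar> \<le> 1"
    unfolding r_def abs_le_iff by (auto simp: field_simps)
  have "pi * s = (x + y) / 2 - of_int n * pi" "pi * r = (x - y) / 2 - of_int n * pi - of_int m * (2 * pi)"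
    by (simp_all add: s_def r_def u_def field_simps)
  then have "pi * (s + r) = x + of_int (- n - m) * (2 * pi)" "pi * (s - r) = y + of_int m * (2 * pi)"
    by (simp_all add: algebra_simps)
  then have eq: "abs_circle (pi * (s + r)) = abs_circle x" "abs_circle (pi * (s - r)) = abs_circle y"
    unfolding abs_circle_eq_iff_int by blast+
  show ?thesis
  proof (cases "r \<ge> 0")
    case True
    then show ?thesis
      using that[OF s, of r] r eq by (simp add: strip_map_def)
  next
    case False
    then have "strip_map (s, - r) = eps (abs_circle x, abs_circle y)"
      using eq eps_swap by (simp add: strip_map_def)
    then show ?thesis
      using that[OF s, of "- r"] r False by simp
  qed
qed

text \<open>Sum and difference of two integers have the same parity. This couples a jump of the
  midpoint with the flip of the half distance.\<close>

lemma int_same_parity_cases: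
  fixes a b :: real and m n :: int
  assumes "a = of_int (m + n)" "b = of_int (m - n)" "\<bar>a\<bar> \<le> 1" "\<bar>b\<bar> \<le> 2"
  shows "a = 0 \<and> b \<in> {-2, 0, 2} \<or> a \<in> {-1, 1} \<and> b \<in> {-1, 1}"
proof -
  define k l where "k = m + n" and "l = m - n"
  have a: "a = of_int k" and b: "b = of_int l"
    using assms(1,2) by (auto simp: k_def l_def)
  have "\<bar>k\<bar> \<le> 1" "\<bar>l\<bar> \<le> 2"
    using assms(3,4) unfolding a b by linarith+
  moreover have "even (k + l)" by (simp add: k_def l_def)
  ultimately have "k = 0 \<and> (l = - 2 \<or> l = 0 \<or> l = 2) \<or> (k = - 1 \<or> k = 1) \<and> (l = - 1 \<or> l = 1)"
    by presburger
  then show ?thesis unfolding a b by auto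
qed

lemma strip_map_eq_iff:
  assumes p: "p \<in> {0..1} \<times> {0..1}" and q: "q \<in> {0..1} \<times> {0..1}"
  shows "strip_map p = strip_map q \<longleftrightarrow> (p, q) \<in> moebius_rel"
proof
  obtain s t s' t' where pq: "p = (s, t)" "q = (s', t')" by fastforce
  with p q have range: "0 \<le> s" "s \<le> 1" "0 \<le> t" "t \<le> 1" "0 \<le> s'" "s' \<le> 1" "0 \<le> t'" "t' \<le> 1"
    by auto
  have shift: "abs_circle (pi * a) = abs_circle (pi * b) \<longleftrightarrow> (\<exists>n. a = b + 2 * of_int n)" for a b
  proof -
    have "pi * b + of_int n * (2 * pi) = pi * (b + 2 * of_int n)" for n
      by (simp add: algebra_simps)
    then show ?thesis unfolding abs_circle_eq_iff_int by simp
  qed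
  have solve: "(\<exists>m. s' + t' = s + r + 2 * of_int m) \<and> (\<exists>n. s' - t' = s - r + 2 * of_int n)
      \<longleftrightarrow> (\<exists>m n. s' - s = of_int (m + n) \<and> t' - r = of_int (m - n))" for r
  proof -
    have "s' + t' = s + r + 2 * of_int m \<and> s' - t' = s - r + 2 * of_int n
        \<longleftrightarrow> s' - s = of_int (m + n) \<and> t' - r = of_int (m - n)" for m n
      unfolding of_int_add of_int_diff by linarith
    then show ?thesis by blast
  qed
  \<comment> \<open>The first alternative comes from equal ordered pairs, the second from swapped
    ones, where \<open>t\<close> becomes \<open>- t\<close>.\<close>
  have eq: "strip_map p = strip_map q \<longleftrightarrow>
      (\<exists>m n. s' - s = of_int (m + n) \<and> t' - t = of_int (m - n)) \<or>
      (\<exists>m n. s' - s = of_int (m + n) \<and> t' + t = of_int (m - n))"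
    unfolding pq strip_map_def prod.case eps_eq_iff insert_iff prod.inject shift solve[of t]
      solve[of "- t", unfolded diff_minus_eq_add add_uminus_conv_diff]
    by simp
  have "p = q \<longleftrightarrow> s' = s \<and> t' = t"
    by (auto simp: pq)
  moreover have "(\<exists>r. {p, q} = {(0, r), (1, 1 - r)}) \<longleftrightarrow>
      s = 0 \<and> s' = 1 \<and> t' = 1 - t \<or> s = 1 \<and> s' = 0 \<and> t' = 1 - t"
    unfolding pq doubleton_eq_iff prod.inject by auto
  ultimately have rel: "(p, q) \<in> moebius_rel \<longleftrightarrow> s' = s \<and> t' = t \<or>
      s = 0 \<and> s' = 1 \<and> t' = 1 - t \<or> s = 1 \<and> s' = 0 \<and> t' = 1 - t"
    using p q by (simp add: moebius_rel_def)
  {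
    assume "strip_map p = strip_map q"
    then consider m n where "s' - s = of_int (m + n)" "t' - t = of_int (m - n)"
      | m n where "s' - s = of_int (m + n)" "t' + t = of_int (m - n)"
      unfolding eq by blast
    then have "s' - s = 0 \<and> t' - t \<in> {-2, 0, 2} \<or> s' - s \<in> {-1, 1} \<and> t' - t \<in> {-1, 1}
        \<or> s' - s = 0 \<and> t' + t \<in> {-2, 0, 2} \<or> s' - s \<in> {-1, 1} \<and> t' + t \<in> {-1, 1}"
    proof cases
      case (1 m n)
      then show ?thesis
        using int_same_parity_cases[OF 1] range by linarith
    next
      case (2 m n)
      then show ?thesis
        using int_same_parity_cases[OF 2] range by linarith
    qed
    \<comment> \<open>In the unit square a difference of 1 or -1 forces opposite endpoints, and
      \<open>t' + t\<close> equal to 0 or 2 forces \<open>t' = t\<close>; what survives is equality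
      or the gluing.\<close>
    then show "(p, q) \<in> moebius_rel"
      unfolding rel using range by (smt (verit) insert_iff empty_iff)
  next
    assume "(p, q) \<in> moebius_rel"
    \<comment> \<open>The integers are spelled out so that the witnesses \<open>m = 1\<close>,
      \<open>n = 0\<close> and \<open>m = 0\<close>, \<open>n = - 1\<close> for the second
      alternative of \<open>eq\<close> can be read off.\<close>
    then consider "s' = s" "t' = t" | "s' - s = of_int (1 + 0)" "t' + t = of_int (1 - 0)"
      | "s' - s = of_int (0 + - 1)" "t' + t = of_int (0 - - 1)"
      unfolding rel by fastforce
    then show "strip_map p = strip_map q"
    proof cases
      case 1
      then show ?thesis by (simp add: pq)
    qed (unfold eq, blast+)
  }
qed

lemma strip_map_image: "strip_map ` ({0..1} \<times> {0..1}) = range eps"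
proof (intro equalityI subsetI)
  fix w assume "w \<in> range eps"
  then obtain x y where w: "w = eps (abs_circle x, abs_circle y)"
    by (metis circle_surj surj_pair imageE)
  obtain s t where "s \<in> {0..1}" "t \<in> {0..1}" "strip_map (s, t) = eps (abs_circle x, abs_circle y)"
    by (rule strip_map_surj)
  then show "w \<in> strip_map ` ({0..1} \<times> {0..1})"
    unfolding w by (metis SigmaI image_eqI)
qed (auto simp: strip_map_def)

text \<open>The two points of a pair coincide exactly when their half distance is 0 or
  \<open>pi\<close>.\<close>

lemma strip_map_boundary: "strip_map ` ({0..1} \<times> {0, 1}) = eps ` diagonal"
proof (intro equalityI subsetI)
  fix w assume "w \<in> strip_map ` ({0..1} \<times> {0, 1})"
  then obtain s t where st: "t = 0 \<or> t = 1" "w = strip_map (s, t)" by auto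
  then have "abs_circle (pi * (s + t)) = abs_circle (pi * (s - t))"
    by (auto simp: abs_circle_eq_iff distrib_left right_diff_distrib cos_diff cos_add sin_diff sin_add)
  with st show "w \<in> eps ` diagonal"
    by (auto simp: strip_map_def diagonal_def)
next
  fix w assume "w \<in> eps ` diagonal"
  then obtain z where "w = eps (z, z)" by (auto simp: diagonal_def)
  moreover obtain x where z: "z = abs_circle x" by (rule circle_surj)
  ultimately have w: "w = eps (abs_circle x, abs_circle x)" by simp
  obtain s t where st: "s \<in> {0..1}" "t \<in> {0..1}" "strip_map (s, t) = w"
    unfolding w by (rule strip_map_surj)
  then have "abs_circle (pi * (s + t)) = abs_circle (pi * (s - t))"
    unfolding w by (auto simp: strip_map_def eps_eq_iff)
  then obtain n where "pi * (s + t) = pi * (s - t) + of_int n * (2 * pi)"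
    unfolding abs_circle_eq_iff_int by blast
  then have "pi * t = pi * of_int n" by (simp add: algebra_simps)
  then have "t = of_int n" by simp
  with st(2) have "n = 0 \<or> n = 1" by auto
  with st \<open>t = of_int n\<close> show "w \<in> strip_map ` ({0..1} \<times> {0, 1})"
    by auto
qed

section \<open>Homeomorphisms from compact quotients\<close>

text \<open>The map descends to a continuous bijection from a compact space to a Hausdorff space,
  which is a homeomorphism.\<close>

lemma homeomorphic_map_from_quotient:
  fixes f :: "'a \<Rightarrow> 'b"
  assumes "equiv (topspace X) R" "compact_space X" "Hausdorff_space Y"
    and cont: "continuous_map X Y f" and surj: "f ` topspace X = topspace Y"
    and inj: "\<And>p q. p \<in> topspace X \<Longrightarrow> q \<in> topspace X \<Longrightarrow> f p = f q \<longleftrightarrow> (p, q) \<in> R"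
  shows "\<exists>h. homeomorphic_map (quotient_topology X R) Y h \<and> (\<forall>p\<in>topspace X. h (R `` {p}) = f p)"
proof -
  note openin_quotient = openin_quotient_topology[OF assms(1)]
  have R_sub: "R \<subseteq> topspace X \<times> topspace X"
    using assms(1) by (auto simp: equiv_def refl_on_def)
  have self: "p \<in> R `` {p}" if "p \<in> topspace X" for p
    using assms(1) that by (rule equiv_class_self)
  have Union: "\<Union>(topspace X // R) = topspace X"
    using assms(1) by (rule Union_quotient)
  have top: "topspace (quotient_topology X R) = topspace X // R"
    by (rule antisym) (use openin_quotient Union in \<open>auto simp: topspace_def[of "quotient_topology X R"]\<close>)
  have quotient: "topspace X // R = (\<lambda>p. R `` {p}) ` topspace X"
    by (auto simp: quotient_def)
  \<comment> \<open>The chosen representative does not matter, since \<open>f\<close> is constant on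
    the classes of \<open>R\<close>.\<close>
  define h where "h = (\<lambda>C. f (SOME p. p \<in> C))"
  have h: "h (R `` {p}) = f p" if "p \<in> topspace X" for p
  proof -
    have "(SOME q. q \<in> R `` {p}) \<in> R `` {p}"
      using self[OF that] by (rule someI)
    then show ?thesis
      using inj[of p "SOME q. q \<in> R `` {p}"] R_sub that by (auto simp: h_def)
  qed
  have proj: "continuous_map X (quotient_topology X R) (\<lambda>p. R `` {p})"
    unfolding continuous_map
  proof (intro conjI allI impI)
    show "(\<lambda>p. R `` {p}) ` topspace X \<subseteq> topspace (quotient_topology X R)"
      by (auto simp: top quotientI)
    fix U assume "openin (quotient_topology X R) U"
    then have U: "U \<subseteq> topspace X // R" "openin X (\<Union>U)"
      by (auto simp: openin_quotient)
    have "{p \<in> topspace X. R `` {p} \<in> U} = \<Union>U"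
    proof (intro equalityI subsetI)
      fix p assume "p \<in> \<Union>U"
      then obtain C where C: "C \<in> U" "p \<in> C" by blast
      then have "C = R `` {p}"
        using U(1) assms(1) by (metis quotientE subsetD equiv_class_eq Image_singleton_iff)
      moreover have "p \<in> topspace X"
        using C U(1) Union by blast
      ultimately show "p \<in> {p \<in> topspace X. R `` {p} \<in> U}" using C by simp
    qed (use self in blast)
    then show "openin X {p \<in> topspace X. R `` {p} \<in> U}" using U(2) by simp
  qed
  have "compact_space (quotient_topology X R)"
    using image_compactin[OF _ proj, of "topspace X"] assms(2)
    by (simp add: compact_space_def top quotient)
  moreover have "continuous_map (quotient_topology X R) Y h"
    unfolding continuous_map
  proof (intro conjI allI impI)
    show "h ` topspace (quotient_topology X R) \<subseteq> topspace Y"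
      using surj h by (auto simp: top quotient)
    fix U assume U: "openin Y U"
    have "\<Union>{C \<in> topspace X // R. h C \<in> U} = {p \<in> topspace X. f p \<in> U}"
    proof (intro equalityI subsetI)
      fix p assume "p \<in> \<Union>{C \<in> topspace X // R. h C \<in> U}"
      then obtain C where C: "C \<in> topspace X // R" "h C \<in> U" "p \<in> C" by blast
      then have "C = R `` {p}" "p \<in> topspace X"
        using assms(1) Union by (metis quotientE equiv_class_eq Image_singleton_iff, blast)
      then show "p \<in> {p \<in> topspace X. f p \<in> U}" using C h by auto
    next
      fix p assume "p \<in> {p \<in> topspace X. f p \<in> U}"
      then show "p \<in> \<Union>{C \<in> topspace X // R. h C \<in> U}"
        using self h by (auto intro!: bexI[of _ "R `` {p}"] quotientI)
    qed
    then show "openin (quotient_topology X R) {C \<in> topspace (quotient_topology X R). h C \<in> U}"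
      using openin_continuous_map_preimage[OF cont U] by (simp add: openin_quotient top)
  qed
  moreover have "h ` topspace (quotient_topology X R) = topspace Y"
    unfolding top surj[symmetric] quotient image_image by (rule image_cong[OF refl h])
  moreover have "inj_on h (topspace (quotient_topology X R))"
  proof (rule inj_onI)
    fix A B assume "A \<in> topspace (quotient_topology X R)" "B \<in> topspace (quotient_topology X R)" "h A = h B"
    then obtain p q where "p \<in> topspace X" "q \<in> topspace X" "A = R `` {p}" "B = R `` {q}" "f p = f q"
      unfolding top quotient using h by auto
    then show "A = B"
      using inj assms(1) by (metis equiv_class_eq)
  qed
  ultimately have "homeomorphic_map (quotient_topology X R) Y h"
    using assms(3) by (intro continuous_imp_homeomorphic_map)
  then show ?thesis using h by blast
qed

lemma is_moebius_strip_eps: "is_moebius_strip (range eps) (eps ` diagonal)"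
proof -
  let ?X = "top_of_set ({0..1} \<times> {0..1} :: (real \<times> real) set)"
  have "equiv (topspace ?X) moebius_rel"
    by (simp add: equiv_moebius_rel)
  moreover have "compact_space ?X"
    by (simp add: compact_space_subtopology compact_Times)
  moreover have "Hausdorff_space (top_of_set (range eps))"
    by (simp add: Hausdorff_space_subtopology)
  moreover have "continuous_map ?X (top_of_set (range eps)) strip_map"
    using continuous_strip_map strip_map_image by auto
  moreover have "strip_map ` topspace ?X = topspace (top_of_set (range eps))"
    by (simp add: strip_map_image)
  moreover have "strip_map p = strip_map q \<longleftrightarrow> (p, q) \<in> moebius_rel" if "p \<in> topspace ?X" "q \<in> topspace ?X" for p q
    using that strip_map_eq_iff by simp
  ultimately have "\<exists>h. homeomorphic_map moebius_strip (top_of_set (range eps)) h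
      \<and> (\<forall>p\<in>topspace ?X. h (moebius_rel `` {p}) = strip_map p)"
    unfolding moebius_strip_def by (rule homeomorphic_map_from_quotient)
  then obtain h where h: "homeomorphic_map moebius_strip (top_of_set (range eps)) h"
    "\<And>p. p \<in> topspace ?X \<Longrightarrow> h (moebius_rel `` {p}) = strip_map p"
    by blast
  have "h ` moebius_boundary = strip_map ` ({0..1} \<times> {0, 1})"
    unfolding moebius_boundary_def image_image
    by (rule image_cong[OF refl], rule h(2)) auto
  with h(1) show ?thesis
    unfolding is_moebius_strip_def strip_map_boundary by blast
qed

theorem theorem3p6:
  shows "(range eps \<subseteq> state_space \<and>
          continuous_on UNIV eps \<and>
          range eps = extreme_states \<and>
          (\<forall>x y x' y'. eps (x, y) = eps (x', y') \<longleftrightarrow> (x', y') \<in> {(x, y), (y, x)}) \<and>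
          is_moebius_strip extreme_states (eps ` diagonal)) \<and>
         extreme_states \<subseteq> disc_singular_set \<and>
         beta ` (UNIV \<times> UNIV \<times> {0..1}) = frontier state_space"
  unfolding extreme_states_eq
proof (intro conjI allI)
  show "range eps \<subseteq> state_space"
    using eps_in_state_space by blast
  show "range eps \<subseteq> disc_singular_set"
    using eps_in_disc_singular_set by blast
qed (rule continuous_eps refl eps_eq_iff is_moebius_strip_eps beta_image_eq_frontier)+

end
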